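(* Let $f$ satisfy Condition 1 with support in $[0,t_0)$ and let $F(z) = \int_0^{t_0} e^{-zt}f(t)\,dt$. Let $B, C$ be constants with $C \ge 0$ and $B > \max(C, t_0)$, and let $d_0 \ge 0$ and an integer $M \ge 1$ be given. Let $c(1), \dots, c(M)$ be real numbers with $c(m) \ge 0$, $c(m) \ge c(m-1)$, and $c(m+1) - c(m) \le c(m) - c(m-1)$ for $m = 2, \dots, M-1$. Consider real variables $d_1 \ge d_2 \ge \dots \ge d_M \ge 0$ subject to the $M$ inequalities \[ \sum_{j \le m} F(d_0 - d_j) \le c(m) + mF(d_0), \qquad m = 1, \dots, M. \] Then the maximum of $S^* = \sum_{j \le M}\bigl(e^{Bd_j} - e^{Cd_j}\bigr)$ under these constraints is achieved for the uniquely determined sequence $\{d_m\}_{m=1}^M$ for which equality holds in all $M$ inequalities above.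
   Context: Condition 1: $f:[0,\infty)\to\mathbb R$ is non-negative and continuous, supported in $[0,t_0)$, twice differentiable on $(0,t_0)$ with $f''$ continuous and bounded, and its Laplace transform $F(z) = \int_0^{t_0} e^{-zt} f(t)\,dt$ satisfies $\mathrm{Re}\,F(z) \ge 0$ for $\mathrm{Re}\,z \ge 0$.
   Formalization: The formal theorem also assumes that f is not identically zero and, for M ≥ 2, that c(2) − c(1) ≤ c(1) (concavity at m=1 with c(0)=0), and takes c(m) ≥ c(m−1) up to m = M; without these no unique admissible equality sequence exists (e.g. M=2, c=(0,1)). *)

theory Defs
  imports "HOL-Analysis.Analysis"
begin

text \<open>Polymorphic in the argument, so that the same definition serves for complex \<open>z\<close> and,
  with a real value, for real \<open>z\<close>; see \<open>laplace_of_real\<close>.\<close>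

definition laplace :: "(real \<Rightarrow> real) \<Rightarrow> real \<Rightarrow> 'a \<Rightarrow> 'a::{real_normed_field,banach}" where
  "laplace f t0 z = integral {0..t0} (\<lambda>t. exp (- z * of_real t) * of_real (f t))"

lemma laplace_of_real:
  assumes "continuous_on {0..t0} f"
  shows "laplace f t0 (complex_of_real x) = complex_of_real (laplace f t0 x)"
proof -
  have "(\<lambda>t. exp (- x * t) * f t) integrable_on {0..t0}"
    by (intro integrable_continuous_interval continuous_intros assms)
  then have "((\<lambda>t. complex_of_real (exp (- x * t) * f t)) has_integral
      complex_of_real (laplace f t0 x)) {0..t0}"
    unfolding laplace_def by (intro has_integral_of_real) (simp add: integrable_integral)
  then show ?thesis
    unfolding laplace_def by (intro integral_unique) (simp add: exp_of_real [symmetric])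
qed

text \<open>A function on \<open>[0,\<infinity>)\<close> is represented by a total function whose values at negative
  arguments are irrelevant.\<close>

definition condition1 :: "(real \<Rightarrow> real) \<Rightarrow> real \<Rightarrow> bool" where
  "condition1 f t0 \<longleftrightarrow>
     (\<forall>t\<ge>0. f t \<ge> 0) \<and>
     continuous_on {0..} f \<and>
     (\<forall>t\<ge>0. f t \<noteq> 0 \<longrightarrow> t \<in> {0..<t0}) \<and>
     (\<exists>f' f''.
        (\<forall>t\<in>{0<..<t0}. (f has_real_derivative f' t) (at t)) \<and>
        (\<forall>t\<in>{0<..<t0}. (f' has_real_derivative f'' t) (at t)) \<and>
        continuous_on {0<..<t0} f'' \<and>
        bounded (f'' ` {0<..<t0})) \<and>
     (\<forall>z::complex. Re z \<ge> 0 \<longrightarrow> Re (laplace f t0 z) \<ge> 0)"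

text \<open>Finite sequences \<open>d\<^sub>1, \<dots>, d\<^sub>M\<close> are extensional functions on \<open>{1..M}\<close>, so that
  equality of such functions is equality of the sequences.\<close>

definition decreasing_seqs :: "nat \<Rightarrow> (nat \<Rightarrow> real) set" where
  "decreasing_seqs M =
     {d \<in> extensional {1..M}. antimono_on {1..M} d \<and> (\<forall>j\<in>{1..M}. d j \<ge> 0)}"

definition feasible ::
  "(real \<Rightarrow> real) \<Rightarrow> real \<Rightarrow> real \<Rightarrow> (nat \<Rightarrow> real) \<Rightarrow> nat \<Rightarrow> (nat \<Rightarrow> real) \<Rightarrow> bool" where
  "feasible f t0 d0 c M d \<longleftrightarrow>
     d \<in> decreasing_seqs M \<and>
     (\<forall>m\<in>{1..M}. (\<Sum>j=1..m. laplace f t0 (d0 - d j)) \<le> c m + real m * laplace f t0 d0)"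

definition all_equal ::
  "(real \<Rightarrow> real) \<Rightarrow> real \<Rightarrow> real \<Rightarrow> (nat \<Rightarrow> real) \<Rightarrow> nat \<Rightarrow> (nat \<Rightarrow> real) \<Rightarrow> bool" where
  "all_equal f t0 d0 c M d \<longleftrightarrow>
     d \<in> decreasing_seqs M \<and>
     (\<forall>m\<in>{1..M}. (\<Sum>j=1..m. laplace f t0 (d0 - d j)) = c m + real m * laplace f t0 d0)"

definition S_star :: "real \<Rightarrow> real \<Rightarrow> nat \<Rightarrow> (nat \<Rightarrow> real) \<Rightarrow> real" where
  "S_star B C M d = (\<Sum>j=1..M. exp (B * d j) - exp (C * d j))"

end

theory Submission
  imports Defs
begin

text \<open>Write \<open>g x = F (d0 - x)\<close> and \<open>h x = exp (B x) - exp (C x)\<close>. In the variables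
  \<open>y\<^sub>j = g (d\<^sub>j) - g 0\<close> the constraints say that \<open>y\<close> is weakly submajorised by the sequence
  \<open>c m - c (m - 1)\<close> (with \<open>c 0 = 0\<close>), which is itself decreasing and non-negative. So it suffices
  that \<open>h \<circ> g\<inverse>\<close> is increasing and convex, i.e. that \<open>\<lambda> = h' / g'\<close> is non-negative and increasing;
  the claim then follows from the tangent line inequality
  \<open>h x - h a \<ge> \<lambda> a (g x - g a)\<close> and Abel summation. As \<open>g\<close> is an average of the functions
  \<open>exp (x t)\<close> with \<open>t < t0 < B\<close>, both facts about \<open>\<lambda>\<close> reduce, after clearing the denominator, to
  inequalities for each single \<open>t\<close>, because \<open>h' x * exp (- x t)\<close> is increasing in \<open>x \<ge> 0\<close>.\<close>

section \<open>Abel summation and inequalities between exponentials\<close>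

lemma Abel_sum_ge:
  fixes l u :: "nat \<Rightarrow> real"
  assumes "M \<ge> 1"
    and "\<And>i. i \<in> {1..<M} \<Longrightarrow> l (Suc i) \<le> l i"
    and "\<And>m. m \<in> {1..M} \<Longrightarrow> (\<Sum>j=1..m. u j) \<ge> 0"
  shows "(\<Sum>j=1..M. l j * u j) \<ge> l M * (\<Sum>j=1..M. u j)"
  using assms
proof (induction M rule: nat_induct_at_least)
  case base
  then show ?case by simp
next
  case (Suc n)
  \<comment> \<open>Lowering the common weight from \<open>l n\<close> to \<open>l (Suc n)\<close>
    only decreases the product, since the partial sum is non-negative.\<close>
  have "l (Suc n) * (\<Sum>j=1..n. u j) \<le> l n * (\<Sum>j=1..n. u j)"
    using Suc by (intro mult_right_mono) auto
  moreover have "l n * (\<Sum>j=1..n. u j) \<le> (\<Sum>j=1..n. l j * u j)"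
    using Suc by auto
  ultimately show ?case
    by (simp add: algebra_simps)
qed

text \<open>This is monotonicity of \<open>h' y * exp (- t y)\<close> on \<open>y \<ge> 0\<close>,
  multiplied by \<open>exp ((a + x) t)\<close> so that it can be integrated over
  \<open>t\<close>.\<close>

lemma exp_diff_deriv_scaled_mono:
  fixes B C t a x :: real
  assumes "0 \<le> C" "C \<le> B" "t \<le> B" "0 \<le> a" "a \<le> x"
  shows "(B * exp (B * a) - C * exp (C * a)) * exp (x * t)
       \<le> (B * exp (B * x) - C * exp (C * x)) * exp (a * t)"
proof -
  define k where "k = (\<lambda>y. B * exp ((B - t) * y) - C * exp ((C - t) * y))"
  have "k a \<le> k x"
  proof (rule DERIV_nonneg_imp_nondecreasing[OF \<open>a \<le> x\<close>])
    fix y assume y: "a \<le> y" "y \<le> x"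
    have "(k has_real_derivative
        B * (B - t) * exp ((B - t) * y) - C * (C - t) * exp ((C - t) * y)) (at y)"
      unfolding k_def by (auto intro!: derivative_eq_intros)
    moreover have "C * (C - t) * exp ((C - t) * y) \<le> B * (B - t) * exp ((B - t) * y)"
    \<comment> \<open>If \<open>C \<le> t\<close>, the two sides have opposite signs; otherwise the
      right side dominates factor by factor, using \<open>y \<ge> 0\<close>.\<close>
    proof (cases "C \<le> t")
      case True
      then have "C * (C - t) * exp ((C - t) * y) \<le> 0"
        using assms by (intro mult_nonpos_nonneg mult_nonneg_nonpos) auto
      also have "0 \<le> B * (B - t) * exp ((B - t) * y)"
        using assms by auto
      finally show ?thesis .
    next
      case False
      then show ?thesis
        using assms y by (intro mult_mono) (auto intro!: mult_right_mono)
    qed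
    ultimately show "\<exists>D. (k has_real_derivative D) (at y) \<and> 0 \<le> D" by force
  qed
  then have "k a * exp (a * t + x * t) \<le> k x * exp (a * t + x * t)"
    by (intro mult_right_mono) auto
  then show ?thesis
    unfolding k_def by (simp add: algebra_simps flip: exp_add)
qed

text \<open>The auxiliary \<open>k\<close> has its minimum over \<open>y \<ge> 0\<close> at
  \<open>a\<close>: by the previous lemma its derivative is non-negative to the right of
  \<open>a\<close> and non-positive to the left.\<close>

lemma exp_diff_tangent:
  fixes B C t a x :: real
  assumes "0 \<le> C" "C \<le> B" "0 \<le> t" "t \<le> B" "0 \<le> a" "0 \<le> x"
  shows "(B * exp (B * a) - C * exp (C * a)) * (exp (x * t) - exp (a * t))
       \<le> ((exp (B * x) - exp (C * x)) - (exp (B * a) - exp (C * a))) * (t * exp (a * t))"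
proof -
  define k where "k = (\<lambda>y. t * exp (a * t) * (exp (B * y) - exp (C * y))
      - (B * exp (B * a) - C * exp (C * a)) * exp (y * t))"
  define k' where "k' = (\<lambda>y. t * ((B * exp (B * y) - C * exp (C * y)) * exp (a * t)
      - (B * exp (B * a) - C * exp (C * a)) * exp (y * t)))"
  have D: "(k has_real_derivative k' y) (at y)" for y
    unfolding k_def k'_def by (auto intro!: derivative_eq_intros simp: algebra_simps)
  have "k a \<le> k x"
  proof (cases "a \<le> x")
    case True
    then show ?thesis
    proof (rule DERIV_nonneg_imp_nondecreasing)
      fix y assume "a \<le> y" "y \<le> x"
      then have "0 \<le> k' y"
        unfolding k'_def using exp_diff_deriv_scaled_mono[of C B t a y] assms by auto
      then show "\<exists>D. (k has_real_derivative D) (at y) \<and> 0 \<le> D" using D by blast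
    qed
  next
    case False
    then have "x \<le> a" by simp
    then show ?thesis
    proof (rule DERIV_nonpos_imp_nonincreasing)
      fix y assume "x \<le> y" "y \<le> a"
      then have "k' y \<le> 0"
        unfolding k'_def using exp_diff_deriv_scaled_mono[of C B t y a] assms
        by (intro mult_nonneg_nonpos) auto
      then show "\<exists>D. (k has_real_derivative D) (at y) \<and> D \<le> 0" using D by blast
    qed
  qed
  then show ?thesis
    unfolding k_def by (simp add: algebra_simps)
qed

section \<open>The Laplace transform on the real line\<close>

text \<open>\<open>laplace_moment f t0\<close> is minus the derivative of \<open>laplace f t0\<close>.\<close>

definition laplace_moment :: "(real \<Rightarrow> real) \<Rightarrow> real \<Rightarrow> real \<Rightarrow> real" where
  "laplace_moment f t0 z = integral {0..t0} (\<lambda>t. t * exp (- z * t) * f t)"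

text \<open>The non-zero value is required at a positive \<open>t\<close> because the integrand of
  the moment carries a factor \<open>t\<close>.\<close>

locale laplace_weight =
  fixes f :: "real \<Rightarrow> real" and t0 :: real
  assumes cont: "continuous_on {0..t0} f"
    and nonneg: "\<And>t. t \<in> {0..t0} \<Longrightarrow> 0 \<le> f t"
    and nonzero: "\<exists>t\<in>{0<..t0}. f t \<noteq> 0"
begin

lemma laplace_integrable: "(\<lambda>t. exp (- z * t) * f t) integrable_on {0..t0}" for z :: real
  by (intro integrable_continuous_interval continuous_intros cont)

lemma laplace_moment_integrable: "(\<lambda>t. t * exp (- z * t) * f t) integrable_on {0..t0}"
  by (intro integrable_continuous_interval continuous_intros cont)

lemma laplace_moment_pos: "laplace_moment f t0 z > 0"
proof -
  let ?k = "\<lambda>t. t * exp (- z * t) * f t"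
  have k: "0 \<le> ?k t" if "t \<in> {0..t0}" for t
    using that nonneg by auto
  obtain s where s: "s \<in> {0<..t0}" "f s \<noteq> 0"
    using nonzero by blast
  have "integral {0..t0} ?k \<noteq> 0"
  proof
    assume "integral {0..t0} ?k = 0"
    moreover have "continuous_on {0..t0} ?k"
      by (intro continuous_intros cont)
    ultimately have "\<forall>t\<in>{0..t0}. ?k t = 0"
      using integral_eq_0_iff[of 0 t0 ?k] k s by auto
    then have "?k s = 0"
      by (rule bspec) (use s in auto)
    then show False using s by simp
  qed
  moreover have "0 \<le> integral {0..t0} ?k"
    by (intro integral_nonneg laplace_moment_integrable) (use k in auto)
  ultimately show ?thesis
    unfolding laplace_moment_def by linarith
qed

text \<open>Integrates an inequality valid for each \<open>t\<close> against the non-negative weight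
  \<open>t * f t * exp (- d0 t)\<close>.\<close>

lemma laplace_moment_mono:
  assumes "\<And>t. t \<in> {0..t0} \<Longrightarrow> p * exp (x * t) \<le> q * exp (a * t)"
  shows "p * laplace_moment f t0 (d0 - x) \<le> q * laplace_moment f t0 (d0 - a)"
proof -
  have "integral {0..t0} (\<lambda>t. p * (t * exp (- (d0 - x) * t) * f t))
      \<le> integral {0..t0} (\<lambda>t. q * (t * exp (- (d0 - a) * t) * f t))"
  proof (rule integral_le)
    fix t assume t: "t \<in> {0..t0}"
    have "t * f t * exp (- d0 * t) * (p * exp (x * t)) \<le> t * f t * exp (- d0 * t) * (q * exp (a * t))"
      using t nonneg[OF t] assms by (intro mult_left_mono) auto
    then show "p * (t * exp (- (d0 - x) * t) * f t) \<le> q * (t * exp (- (d0 - a) * t) * f t)"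
      by (simp add: algebra_simps exp_diff exp_minus field_simps)
  qed (intro integrable_on_mult_right laplace_moment_integrable)+
  then show ?thesis
    by (simp add: laplace_moment_def)
qed

lemma laplace_diff_le_moment:
  assumes "\<And>t. t \<in> {0..t0} \<Longrightarrow> q * (exp (x * t) - exp (a * t)) \<le> p * (t * exp (a * t))"
  shows "q * (laplace f t0 (d0 - x) - laplace f t0 (d0 - a)) \<le> p * laplace_moment f t0 (d0 - a)"
proof -
  have "integral {0..t0} (\<lambda>t. q * (exp (- (d0 - x) * t) * f t - exp (- (d0 - a) * t) * f t))
      \<le> integral {0..t0} (\<lambda>t. p * (t * exp (- (d0 - a) * t) * f t))"
  proof (rule integral_le)
    fix t assume t: "t \<in> {0..t0}"
    have "f t * exp (- d0 * t) * (q * (exp (x * t) - exp (a * t)))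
        \<le> f t * exp (- d0 * t) * (p * (t * exp (a * t)))"
      using t nonneg[OF t] assms by (intro mult_left_mono) auto
    then show "q * (exp (- (d0 - x) * t) * f t - exp (- (d0 - a) * t) * f t)
        \<le> p * (t * exp (- (d0 - a) * t) * f t)"
      by (simp add: algebra_simps exp_diff exp_minus field_simps)
  qed (intro integrable_on_mult_right integrable_diff laplace_integrable laplace_moment_integrable)+
  then show ?thesis
    using integral_diff[OF laplace_integrable laplace_integrable, of "d0 - x" "d0 - a"]
    by (simp add: laplace_moment_def laplace_def)
qed

lemma laplace_convex:
  "laplace f t0 (d0 - x) \<ge> laplace f t0 (d0 - a) + (x - a) * laplace_moment f t0 (d0 - a)"
proof -
  \<comment> \<open>This is \<open>1 + s \<le> exp s\<close> at \<open>s = (x - a) t\<close>; the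
    factor -1 turns the upper bound of \<open>laplace_diff_le_moment\<close> into a lower
    one.\<close>
  have "- 1 * (exp (x * t) - exp (a * t)) \<le> - (x - a) * (t * exp (a * t))" for t
  proof -
    have "exp (a * t) * (1 + (x - a) * t) \<le> exp (a * t) * exp ((x - a) * t)"
      using exp_ge_add_one_self by (intro mult_left_mono) auto
    then show ?thesis
      by (simp add: algebra_simps flip: exp_add)
  qed
  from laplace_diff_le_moment[OF this] show ?thesis
    by (simp add: algebra_simps)
qed

lemma laplace_strict_mono: "x < y \<Longrightarrow> laplace f t0 (d0 - x) < laplace f t0 (d0 - y)" for d0 x y :: real
  using laplace_convex[of d0 x y] laplace_moment_pos[of "d0 - x"]
  by (smt (verit) mult_pos_pos)

lemma laplace_le_iff: "laplace f t0 (d0 - x) \<le> laplace f t0 (d0 - y) \<longleftrightarrow> x \<le> y" for d0 x y :: real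
  using laplace_strict_mono[of x y d0] laplace_strict_mono[of y x d0]
  by (cases x y rule: linorder_cases) auto

lemma laplace_continuous: "continuous_on UNIV (\<lambda>x. laplace f t0 (d0 - x))" for d0 :: real
proof -
  have "continuous_on UNIV (\<lambda>x. integral (cbox 0 t0) (\<lambda>t. exp (- (d0 - x) * t) * f t))"
    by (rule integral_continuous_on_param)
      (auto intro!: continuous_intros continuous_on_compose2[OF cont] simp: case_prod_unfold)
  then show ?thesis by (simp add: laplace_def)
qed

lemma laplace_surj:
  fixes d0 v :: real
  assumes "0 \<le> v"
  obtains x where "0 \<le> x" "laplace f t0 (d0 - x) = laplace f t0 d0 + v"
proof -
  \<comment> \<open>At \<open>b\<close> the tangent at 0 has risen by exactly \<open>v\<close>, so
    by convexity the transform has risen at least that much.\<close>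
  define b where "b = v / laplace_moment f t0 d0"
  have b: "0 \<le> b" "b * laplace_moment f t0 d0 = v"
    using assms laplace_moment_pos[of d0] by (auto simp: b_def)
  have "\<exists>x\<ge>0. x \<le> b \<and> laplace f t0 (d0 - x) = laplace f t0 d0 + v"
    using IVT'[of "\<lambda>x. laplace f t0 (d0 - x)" 0 "laplace f t0 d0 + v" b] laplace_convex[of d0 0 b]
      assms b continuous_on_subset[OF laplace_continuous] by auto
  then show ?thesis using that by blast
qed

section \<open>Comparison of \<open>S_star\<close> under weak submajorisation\<close>

lemma S_star_le_of_partial_sums_le:
  assumes BC: "0 \<le> C" "C < B" "t0 \<le> B"
    and M: "M \<ge> 1"
    and d: "d \<in> decreasing_seqs M" and e: "\<And>j. j \<in> {1..M} \<Longrightarrow> 0 \<le> e j"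
    and le: "\<And>m. m \<in> {1..M} \<Longrightarrow>
      (\<Sum>j=1..m. laplace f t0 (d0 - d j)) \<le> (\<Sum>j=1..m. laplace f t0 (d0 - e j))"
  shows "S_star B C M d \<le> S_star B C M e"
proof -
  define h' where "h' = (\<lambda>a. B * exp (B * a) - C * exp (C * a))"
  \<comment> \<open>The signs from the moment and from \<open>d0 - a\<close> cancel, so the
    denominator is the derivative of \<open>laplace f t0 (d0 - a)\<close> in
    \<open>a\<close>.\<close>
  define l where "l = (\<lambda>a. h' a / laplace_moment f t0 (d0 - a))"
  define u where "u = (\<lambda>j. laplace f t0 (d0 - e j) - laplace f t0 (d0 - d j))"
  note pos = laplace_moment_pos
  have dnn: "0 \<le> d j" if "j \<in> {1..M}" for j
    using d that by (auto simp: decreasing_seqs_def)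
  have dmono: "d (Suc j) \<le> d j" if "j \<in> {1..<M}" for j
    using d that by (auto simp: decreasing_seqs_def intro: monotone_onD)
  have l_mono: "l a \<le> l x" if "0 \<le> a" "a \<le> x" for a x
  proof -
    have "h' a * laplace_moment f t0 (d0 - x) \<le> h' x * laplace_moment f t0 (d0 - a)"
      unfolding h'_def using BC that
      by (intro laplace_moment_mono exp_diff_deriv_scaled_mono) auto
    then show ?thesis
      using pos[of "d0 - a"] pos[of "d0 - x"] by (simp add: l_def field_simps)
  qed
  have l_nonneg: "0 \<le> l a" if "0 \<le> a" for a
  proof -
    have "C * exp (C * a) \<le> B * exp (B * a)"
      using BC that by (intro mult_mono) (auto intro!: mult_right_mono)
    then show ?thesis
      using pos[of "d0 - a"] by (simp add: l_def h'_def)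
  qed
  have "l (d j) * u j \<le> (exp (B * e j) - exp (C * e j)) - (exp (B * d j) - exp (C * d j))"
    if "j \<in> {1..M}" for j
  proof -
    have "h' (d j) * u j \<le> ((exp (B * e j) - exp (C * e j)) - (exp (B * d j) - exp (C * d j)))
        * laplace_moment f t0 (d0 - d j)"
      unfolding h'_def u_def using BC dnn[OF that] e[OF that]
      by (intro laplace_diff_le_moment exp_diff_tangent) auto
    then show ?thesis
      using pos[of "d0 - d j"] by (simp add: l_def field_simps)
  qed
  then have "(\<Sum>j=1..M. l (d j) * u j) \<le> S_star B C M e - S_star B C M d"
    unfolding S_star_def sum_subtractf[symmetric] by (intro sum_mono) auto
  moreover have usum: "0 \<le> (\<Sum>j=1..m. u j)" if "m \<in> {1..M}" for m
    using le[OF that] by (simp add: u_def sum_subtractf)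
  have "l (d M) * (\<Sum>j=1..M. u j) \<le> (\<Sum>j=1..M. l (d j) * u j)"
  proof (rule Abel_sum_ge[OF M])
    show "l (d (Suc i)) \<le> l (d i)" if "i \<in> {1..<M}" for i
      using that dmono dnn by (intro l_mono) auto
  qed (rule usum)
  \<comment> \<open>The majorisation is weak: the total of \<open>u\<close> may be positive, so the
    sign of the last weight matters.\<close>
  moreover have "0 \<le> l (d M) * (\<Sum>j=1..M. u j)"
    using M dnn by (intro mult_nonneg_nonneg l_nonneg usum) auto
  ultimately show ?thesis by linarith
qed

section \<open>Uniqueness and existence of the sequence with equality throughout\<close>

lemma all_equal_unique:
  assumes d: "all_equal f t0 d0 c M d" and e: "all_equal f t0 d0 c M e"
  shows "d = e"
proof (rule extensionalityI[of _ "{1..M}"])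
  fix j assume j: "j \<in> {1..M}"
  \<comment> \<open>The empty sum \<open>m = 0\<close> is included so that subtracting consecutive
    sums also isolates the first term.\<close>
  have sums: "(\<Sum>i=1..m. laplace f t0 (d0 - d i)) = (\<Sum>i=1..m. laplace f t0 (d0 - e i))"
    if "m \<le> M" for m
    using d e that unfolding all_equal_def by (cases "m = 0") auto
  have "{1..j} = insert j {1..j - 1}"
    using j by auto
  then have "laplace f t0 (d0 - d j) = laplace f t0 (d0 - e j)"
    using sums[of j] sums[of "j - 1"] j by auto
  then show "d j = e j"
    using laplace_le_iff[of d0 "d j" "e j"] laplace_le_iff[of d0 "e j" "d j"] by simp
qed (use d e in \<open>auto simp: all_equal_def decreasing_seqs_def\<close>)

lemma all_equal_exists:
  fixes c :: "nat \<Rightarrow> real"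
  assumes nn: "\<forall>m\<in>{1..M}. c m \<ge> 0"
    and mono: "\<forall>m\<in>{2..M}. c m \<ge> c (m - 1)"
    and concave: "\<forall>m\<in>{2..M - 1}. c (m + 1) - c m \<le> c m - c (m - 1)"
    and start: "M \<ge> 2 \<longrightarrow> c 2 - c 1 \<le> c 1"
  shows "\<exists>d. all_equal f t0 d0 c M d"
proof -
  \<comment> \<open>The case \<open>m = 1\<close> encodes the convention that \<open>c\<close>
    vanishes at 0, as the value \<open>c 0\<close> is arbitrary.\<close>
  define y where "y = (\<lambda>m. if m = 1 then c 1 else c m - c (m - 1))"
  have y: "0 \<le> y m" if "m \<in> {1..M}" for m
    using that nn mono unfolding y_def by (cases "m = 1") auto
  have y_sum: "(\<Sum>j=1..m. y j) = c m" if "m \<ge> 1" for m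
    using that by (induction m rule: nat_induct_at_least) (auto simp: y_def)
  have y_step: "y (Suc m) \<le> y m" if "1 \<le> m" "m < M" for m
  proof (cases "m = 1")
    case True
    then show ?thesis using start that by (auto simp: y_def numeral_2_eq_2)
  next
    case False
    then have "m \<in> {2..M - 1}" using that by auto
    then show ?thesis using concave False by (auto simp: y_def)
  qed
  have y_anti: "y n \<le> y m" if "m \<le> n" "1 \<le> m" "n \<le> M" for m n
    using that by (induction n rule: dec_induct) (auto intro: order_trans[OF y_step])
  have "\<forall>j\<in>{1..M}. \<exists>x\<ge>0. laplace f t0 (d0 - x) = laplace f t0 d0 + y j"
    using laplace_surj y by metis
  then obtain d' where d': "\<forall>j\<in>{1..M}. 0 \<le> d' j \<and> laplace f t0 (d0 - d' j) = laplace f t0 d0 + y j"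
    by metis
  define d where "d = restrict d' {1..M}"
  have d: "0 \<le> d j" "laplace f t0 (d0 - d j) = laplace f t0 d0 + y j" if "j \<in> {1..M}" for j
    using d' that by (auto simp: d_def)
  have "antimono_on {1..M} d"
  proof (rule monotone_onI)
    fix m n assume mn: "m \<in> {1..M}" "n \<in> {1..M}" "m \<le> n"
    have "laplace f t0 (d0 - d n) \<le> laplace f t0 (d0 - d m)"
      using d(2) mn y_anti[of m n] by simp
    then show "d n \<le> d m" by (simp add: laplace_le_iff)
  qed
  moreover have "(\<Sum>j=1..m. laplace f t0 (d0 - d j)) = c m + real m * laplace f t0 d0"
    if "m \<in> {1..M}" for m
  proof -
    have "(\<Sum>j=1..m. laplace f t0 (d0 - d j)) = (\<Sum>j=1..m. laplace f t0 d0 + y j)"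
      using that by (intro sum.cong d) auto
    then show ?thesis using y_sum that by (simp add: sum.distrib)
  qed
  moreover have "d \<in> extensional {1..M}"
    by (simp add: d_def)
  ultimately have "all_equal f t0 d0 c M d"
    using d(1) by (auto simp: all_equal_def decreasing_seqs_def)
  then show ?thesis by blast
qed

end

section \<open>From Condition 1 to the maximum\<close>

lemma condition1_imp_laplace_weight:
  assumes "condition1 f t0" and "\<exists>t\<ge>0. f t \<noteq> 0"
  shows "laplace_weight f t0"
proof
  have c: "continuous_on {0..} f" and supp: "\<And>t. 0 \<le> t \<Longrightarrow> f t \<noteq> 0 \<Longrightarrow> t \<in> {0..<t0}"
    using assms(1) by (auto simp: condition1_def)
  show cont: "continuous_on {0..t0} f"
    by (rule continuous_on_subset[OF c]) auto
  show "0 \<le> f t" if "t \<in> {0..t0}" for t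
    using assms(1) that by (auto simp: condition1_def)
  obtain s where s: "0 \<le> s" "f s \<noteq> 0" "s < t0"
    using assms(2) supp by fastforce
  show "\<exists>t\<in>{0<..t0}. f t \<noteq> 0"
  proof (rule ccontr)
    assume "\<not> (\<exists>t\<in>{0<..t0}. f t \<noteq> 0)"
    then have zero: "f t = 0" if "t \<in> {0<..t0}" for t
      using that by blast
    \<comment> \<open>Since \<open>s\<close> may be 0, the vanishing on the open interval is carried
      to its closure by continuity.\<close>
    have "f s = 0"
    proof (rule continuous_constant_on_closure[of "{0<..<t0}" f])
      show "continuous_on (closure {0<..<t0}) f"
        using s cont by simp
    qed (use zero s in auto)
    then show False using s by simp
  qed
qed

text \<open>For \<open>f = 0\<close> every sequence is feasible and \<open>S_star\<close> is
  unbounded, hence the non-vanishing assumption. Monotonicity of \<open>c\<close> up to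
  \<open>M\<close> makes the last term of the equality sequence non-negative, and the condition on
  \<open>c 2\<close> is concavity at 1 with \<open>c\<close> taken as 0 at 0, which gives
  \<open>d 2 \<le> d 1\<close>.\<close>

theorem theoremL:
  fixes f :: "real \<Rightarrow> real" and t0 B C d0 :: real and M :: nat and c :: "nat \<Rightarrow> real"
  assumes "condition1 f t0"
    and "\<exists>t\<ge>0. f t \<noteq> 0"
    and "C \<ge> 0" and "B > max C t0"
    and "d0 \<ge> 0" and "M \<ge> 1"
    and "\<forall>m\<in>{1..M}. c m \<ge> 0"
    and "\<forall>m\<in>{2..M}. c m \<ge> c (m - 1)"
    and "\<forall>m\<in>{2..M - 1}. c (m + 1) - c m \<le> c m - c (m - 1)"
    and "M \<ge> 2 \<longrightarrow> c 2 - c 1 \<le> c 1"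
  shows "\<exists>d. all_equal f t0 d0 c M d \<and>
             (\<forall>d'. all_equal f t0 d0 c M d' \<longrightarrow> d' = d) \<and>
             is_arg_max (S_star B C M) (feasible f t0 d0 c M) d"
proof -
  interpret laplace_weight f t0
    using condition1_imp_laplace_weight assms(1,2) .
  obtain d where d: "all_equal f t0 d0 c M d"
    using all_equal_exists assms(7-10) by blast
  have "S_star B C M e \<le> S_star B C M d" if "feasible f t0 d0 c M e" for e
    by (rule S_star_le_of_partial_sums_le[where ?d0.0 = d0])
      (use assms d that in \<open>auto simp: all_equal_def feasible_def decreasing_seqs_def\<close>)
  moreover have "feasible f t0 d0 c M d"
    using d by (simp add: all_equal_def feasible_def)
  ultimately have "is_arg_max (S_star B C M) (feasible f t0 d0 c M) d"
    by (auto simp: is_arg_max_def not_less)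
  then show ?thesis
    using d all_equal_unique by blast
qed

end
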